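(* For every $0<\delta<1/2$, $$\kappa_H(\delta)=R_{\mathrm{MQC}}(\delta).$$ More explicitly, with $\sigma=1-2\delta$ and $u\in[\sigma,1]$, the closed whole-cube spectral boundary is parametrized by $$a=\mathsf J(u^2),\qquad b=\mathsf J\big(u(u-\sigma)\big),$$ and at this point $\Gamma_H(a,b)=\sigma$ and the objective $H_2(a)-H_2(b)$ equals $g(u^2)-g(u(u-\sigma))$.
   Context: $H_2(t)=-t\log_2t-(1-t)\log_2(1-t)$ ($0\log_20=0$). $\mathsf J(q)=\frac{1-\sqrt{1-q}}2$ and $g(q)=H_2(\mathsf J(q))$ for $0\le q\le1$. $\Gamma_H(a,b)=\frac{2(a-b)(1-a-b)}{\sqrt{a(1-a)}}$, and $$\kappa_H(\delta)=\inf\{H_2(a)-H_2(b):\ 0\le b<a\le\tfrac12,\ \Gamma_H(a,b)>1-2\delta\},$$ $$R_{\mathrm{MQC}}(\delta)=\min_{1-2\delta\le u\le1}\big\{g(u^2)-g\big(u(u-(1-2\delta))\big)\big\}.$$ The closed whole-cube spectral boundary is the set of $(a,b)$ with $0\le b<a\le\frac12$ and $\Gamma_H(a,b)=1-2\delta$. *)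

theory Defs
  imports "HOL-Analysis.Analysis" "HOL-Real_Asymp.Real_Asymp"
begin

text \<open>Since \<open>log 2 0\<close> is a real number in HOL, the convention \<open>0 * log 2 0 = 0\<close> holds
  automatically at both endpoints of \<open>[0, 1]\<close>.\<close>

definition H2 :: "real \<Rightarrow> real" where
  "H2 t = - t * log 2 t - (1 - t) * log 2 (1 - t)"

definition J :: "real \<Rightarrow> real" where
  "J q = (1 - sqrt (1 - q)) / 2"

definition g :: "real \<Rightarrow> real" where
  "g q = H2 (J q)"

definition Gamma_H :: "real \<Rightarrow> real \<Rightarrow> real" where
  "Gamma_H a b = 2 * (a - b) * (1 - a - b) / sqrt (a * (1 - a))"

text \<open>The infimum is over a nonempty set that is bounded below; see
  \<open>kappa_H_set_nonempty\<close> and \<open>kappa_H_set_bdd_below\<close>.\<close>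

definition kappa_H :: "real \<Rightarrow> real" where
  "kappa_H \<delta> = Inf {H2 a - H2 b |a b.
     0 \<le> b \<and> b < a \<and> a \<le> 1/2 \<and> Gamma_H a b > 1 - 2 * \<delta>}"

text \<open>\<open>Least\<close> on the reals selects the minimum of the set of values; it exists by
  \<open>R_MQC_attained\<close>.\<close>

definition R_MQC :: "real \<Rightarrow> real" where
  "R_MQC \<delta> = (LEAST r. r \<in>
     (\<lambda>u. g (u\<^sup>2) - g (u * (u - (1 - 2 * \<delta>)))) ` {1 - 2 * \<delta>..1})"

definition spectral_boundary :: "real \<Rightarrow> (real \<times> real) set" where
  "spectral_boundary \<delta> =
     {(a, b). 0 \<le> b \<and> b < a \<and> a \<le> 1/2 \<and> Gamma_H a b = 1 - 2 * \<delta>}"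

lemma continuous_on_x_log: "continuous_on {0..} (\<lambda>t::real. t * log 2 t)"
proof (rule continuous_on_eq_continuous_within[THEN iffD2], rule ballI)
  fix x :: real assume "x \<in> {0..}"
  show "continuous (at x within {0..}) (\<lambda>t. t * log 2 t)"
  proof (cases "x = 0")
    case True
    have "((\<lambda>t::real. t * log 2 t) \<longlongrightarrow> 0) (at_right 0)"
      by real_asymp
    then have "((\<lambda>t::real. t * log 2 t) \<longlongrightarrow> 0) (at 0 within {0..})"
      by (simp add: at_within_Ici_at_right)
    then show ?thesis
      by (simp add: True continuous_within)
  next
    case False
    with \<open>x \<in> {0..}\<close> have "x > 0" by simp
    then have "isCont (\<lambda>t. t * log 2 t) x"
      by (auto intro!: continuous_intros)
    then show ?thesis
      by (rule continuous_at_imp_continuous_within)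
  qed
qed

lemma continuous_on_H2: "continuous_on {0..1} H2"
proof -
  have 1: "continuous_on {0..1} (\<lambda>t::real. t * log 2 t)"
    by (rule continuous_on_subset[OF continuous_on_x_log]) auto
  have 2: "continuous_on {0..1} (\<lambda>t::real. (1 - t) * log 2 (1 - t))"
    by (rule continuous_on_compose2[OF continuous_on_x_log, where f = "\<lambda>t. 1 - t"])
      (auto intro!: continuous_intros)
  have "continuous_on {0..1} (\<lambda>t::real. - (t * log 2 t) - (1 - t) * log 2 (1 - t))"
    by (intro continuous_on_diff continuous_on_minus 1 2)
  then show ?thesis
    by (simp add: H2_def[abs_def])
qed

lemma continuous_on_g: "continuous_on {0..1} g"
  unfolding g_def J_def
proof (rule continuous_on_compose2[OF continuous_on_H2])
  show "(\<lambda>q::real. (1 - sqrt (1 - q)) / 2) ` {0..1} \<subseteq> {0..1}"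
  proof (rule image_subsetI)
    fix q :: real assume "q \<in> {0..1}"
    then have q: "0 \<le> sqrt (1 - q)" "sqrt (1 - q) \<le> 1" by auto
    have "0 \<le> (1 - sqrt (1 - q)) / 2" using q(2) by simp
    moreover have "(1 - sqrt (1 - q)) / 2 \<le> 1" using q(1) by (simp del: real_sqrt_ge_0_iff)
    ultimately show "(1 - sqrt (1 - q)) / 2 \<in> {0..1}"
      by (simp only: atLeastAtMost_iff)
  qed
qed (auto intro!: continuous_intros)

lemma kappa_H_set_nonempty:
  assumes "0 < \<delta>"
  shows "{H2 a - H2 b |a b.
     0 \<le> b \<and> b < a \<and> a \<le> 1/2 \<and> Gamma_H a b > 1 - 2 * \<delta>} \<noteq> {}"
proof -
  have "Gamma_H (1/2) 0 = 1"
    by (simp add: Gamma_H_def real_sqrt_divide)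
  with assms have "H2 (1/2) - H2 0 \<in> {H2 a - H2 b |a b.
     0 \<le> b \<and> b < a \<and> a \<le> 1/2 \<and> Gamma_H a b > 1 - 2 * \<delta>}"
    by (intro CollectI exI[of _ "1/2"] exI[of _ 0]) simp
  then show ?thesis by blast
qed

lemma kappa_H_set_bdd_below:
  "bdd_below {H2 a - H2 b |a b.
     0 \<le> b \<and> b < a \<and> a \<le> 1/2 \<and> Gamma_H a b > 1 - 2 * \<delta>}"
proof -
  have "compact (H2 ` {0..1})"
    by (rule compact_continuous_image[OF continuous_on_H2]) simp
  then obtain B where B: "\<And>t. t \<in> {0..1} \<Longrightarrow> \<bar>H2 t\<bar> \<le> B"
    by (metis bounded_iff compact_imp_bounded imageI real_norm_def)
  show ?thesis
  proof (rule bdd_belowI[of _ "- 2 * B"])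
    fix x assume "x \<in> {H2 a - H2 b |a b.
      0 \<le> b \<and> b < a \<and> a \<le> 1/2 \<and> Gamma_H a b > 1 - 2 * \<delta>}"
    then obtain a b where "x = H2 a - H2 b" "0 \<le> b" "b < a" "a \<le> 1/2"
      by blast
    then show "- 2 * B \<le> x"
      using B[of a] B[of b] by auto
  qed
qed

lemma R_MQC_attained:
  assumes "0 < \<delta>" "\<delta> < 1/2"
  shows "\<exists>u\<in>{1 - 2 * \<delta>..1}.
     R_MQC \<delta> = g (u\<^sup>2) - g (u * (u - (1 - 2 * \<delta>))) \<and>
     (\<forall>v\<in>{1 - 2 * \<delta>..1}. R_MQC \<delta> \<le> g (v\<^sup>2) - g (v * (v - (1 - 2 * \<delta>))))"
proof -
  let ?I = "{1 - 2 * \<delta>..1}"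
  let ?f = "\<lambda>u. g (u\<^sup>2) - g (u * (u - (1 - 2 * \<delta>)))"
  have 1: "continuous_on ?I (\<lambda>u. g (u\<^sup>2))"
    by (rule continuous_on_compose2[OF continuous_on_g])
      (use assms in \<open>auto intro!: continuous_intros power_le_one\<close>)
  have 2: "continuous_on ?I (\<lambda>u. g (u * (u - (1 - 2 * \<delta>))))"
    by (rule continuous_on_compose2[OF continuous_on_g])
      (use assms in \<open>auto intro!: continuous_intros mult_nonneg_nonneg mult_le_one\<close>)
  have "continuous_on ?I ?f"
    by (intro continuous_on_diff 1 2)
  then obtain u where u: "u \<in> ?I" "\<forall>v\<in>?I. ?f u \<le> ?f v"
    using continuous_attains_inf[of ?I ?f] assms by auto
  have "R_MQC \<delta> = ?f u"
    unfolding R_MQC_def by (rule Least_equality) (use u in auto)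
  with u show ?thesis by auto
qed

end

(* In the coordinates u = 2 sqrt (a (1 - a)) and y = 4 b (1 - b) one has a = J (u^2), b = J y and
   Gamma_H a b = (u^2 - y) / u, so Gamma_H a b = s is solved by y = u (u - s), with y \<ge> 0 exactly
   when u \<ge> s.  Since H2 increases on [0, 1/2], moving b up to the boundary lowers the objective;
   conversely each boundary point is a limit of interior points lying on the curves for s > \<sigma>. *)

theory Submission
  imports Defs
begin

text \<open>\<open>J q\<close> is the smaller root of t (1 - t) = q / 4, and
  \<open>q \<le> 1\<close> makes the roots real.\<close>

lemma J_times_one_minus_J:
  assumes "q \<le> 1"
  shows "J q * (1 - J q) = q / 4"
proof -
  have "sqrt (1 - q) * sqrt (1 - q) = 1 - q"
    using assms by simp
  then show ?thesis
    by (simp add: J_def field_simps)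
qed

text \<open>The bound on \<open>a\<close> fixes the branch of the root: sqrt ((1 - 2a)^2) is 1 - 2a
  rather than 2a - 1.\<close>

lemma J_four_times:
  assumes "a \<le> 1/2"
  shows "J (4 * a * (1 - a)) = a"
proof -
  have "1 - 4 * a * (1 - a) = (1 - 2 * a)\<^sup>2"
    by (simp add: power2_eq_square algebra_simps)
  with assms show ?thesis
    by (simp add: J_def)
qed

lemma J_less: "q < r \<Longrightarrow> J q < J r"
  by (simp add: J_def)

lemma J_le: "q \<le> r \<Longrightarrow> J q \<le> J r"
  by (simp add: J_def)

lemma J_nonneg: "0 \<le> q \<Longrightarrow> 0 \<le> J q"
  by (simp add: J_def)

lemma J_le_half: "q \<le> 1 \<Longrightarrow> J q \<le> 1/2"
  by (simp add: J_def)

lemma inj_on_J: "inj_on J {..1}"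
  by (rule inj_onI) (simp add: J_def)

text \<open>Since (a - b)(1 - a - b) = a(1 - a) - b(1 - b), the numerator depends only on the two
  quarter products u^2 / 4 and y / 4, while the denominator becomes u / 2.\<close>

lemma Gamma_H_J:
  assumes "0 < u" "u \<le> 1" "y \<le> 1"
  shows "Gamma_H (J (u\<^sup>2)) (J y) = (u\<^sup>2 - y) / u"
proof -
  have u: "u\<^sup>2 \<le> 1"
    using assms by (simp add: power_le_one)
  have "(J (u\<^sup>2) - J y) * (1 - J (u\<^sup>2) - J y) = J (u\<^sup>2) * (1 - J (u\<^sup>2)) - J y * (1 - J y)"
    by (simp add: algebra_simps)
  also have "\<dots> = (u\<^sup>2 - y) / 4"
    using u assms by (simp add: J_times_one_minus_J)
  finally have 1: "(J (u\<^sup>2) - J y) * (1 - J (u\<^sup>2) - J y) = (u\<^sup>2 - y) / 4" .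
  have 2: "sqrt (J (u\<^sup>2) * (1 - J (u\<^sup>2))) = u / 2"
    using u assms by (simp add: J_times_one_minus_J real_sqrt_divide)
  show ?thesis
    unfolding Gamma_H_def mult.assoc 1 2 using assms(1) by (simp add: divide_simps)
qed

lemma spectral_coordinates:
  assumes "0 \<le> b" "b < a" "a \<le> 1/2"
  obtains u y where "0 < u" "u \<le> 1" "0 \<le> y" "y \<le> 1" "a = J (u\<^sup>2)" "b = J y"
    "Gamma_H a b = (u\<^sup>2 - y) / u"
proof -
  define u where "u = sqrt (4 * a * (1 - a))"
  define y where "y = 4 * b * (1 - b)"
  have le: "4 * t * (1 - t) \<le> 1" for t :: real
    using zero_le_power2[of "2 * t - 1"] by (simp add: power2_eq_square algebra_simps)
  have pos: "0 < 4 * a * (1 - a)" using assms by simp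
  have u: "0 < u" "u \<le> 1" "u\<^sup>2 = 4 * a * (1 - a)"
    using pos le[of a] by (simp_all add: u_def)
  have y: "0 \<le> y" "y \<le> 1"
    using assms le[of b] by (simp_all add: y_def)
  have a: "a = J (u\<^sup>2)" and b: "b = J y"
    using assms J_four_times[of a] J_four_times[of b] by (simp_all only: u y_def)
  show thesis
    using that[OF u(1,2) y a b] Gamma_H_J[OF u(1,2) y(2)] a b by simp
qed

lemma boundary_coordinate_bounds:
  fixes u s :: real
  assumes "0 \<le> s" "s \<le> u" "u \<le> 1"
  shows "0 \<le> u * (u - s)" "u * (u - s) \<le> 1" "0 \<le> u\<^sup>2" "u\<^sup>2 \<le> 1"
  using assms by (auto intro!: mult_le_one simp: power_le_one)

text \<open>The level \<open>s\<close> is arbitrary so that, besides the boundary itself, the nearby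
  curves at levels above \<sigma> are covered; the limit argument for \<open>kappa_H\<close> moves
  across these.\<close>

lemma boundary_point:
  assumes "0 < s" "s \<le> u" "u \<le> 1"
  shows "0 \<le> J (u * (u - s))" "J (u * (u - s)) < J (u\<^sup>2)" "J (u\<^sup>2) \<le> 1/2"
    "Gamma_H (J (u\<^sup>2)) (J (u * (u - s))) = s"
proof -
  note bd = boundary_coordinate_bounds[of s u]
  have "u * (u - s) < u\<^sup>2"
    using assms by (simp add: power2_eq_square algebra_simps)
  then show "J (u * (u - s)) < J (u\<^sup>2)"
    by (rule J_less)
  show "0 \<le> J (u * (u - s))" "J (u\<^sup>2) \<le> 1/2"
    using assms bd by (simp_all only: J_nonneg J_le_half)
  have "Gamma_H (J (u\<^sup>2)) (J (u * (u - s))) = (u\<^sup>2 - u * (u - s)) / u"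
    using assms bd by (intro Gamma_H_J) auto
  also have "\<dots> = s"
    using assms by (simp add: power2_eq_square algebra_simps)
  finally show "Gamma_H (J (u\<^sup>2)) (J (u * (u - s))) = s" .
qed

lemma bij_betw_spectral_boundary:
  assumes "\<delta> < 1/2"
  defines "\<sigma> \<equiv> 1 - 2 * \<delta>"
  shows "bij_betw (\<lambda>u. (J (u\<^sup>2), J (u * (u - \<sigma>)))) {\<sigma>..1} (spectral_boundary \<delta>)"
  unfolding bij_betw_def
proof
  have \<sigma>: "0 < \<sigma>" using assms by simp
  show "inj_on (\<lambda>u. (J (u\<^sup>2), J (u * (u - \<sigma>)))) {\<sigma>..1}"
  proof (rule inj_onI)
    fix u v assume uv: "u \<in> {\<sigma>..1}" "v \<in> {\<sigma>..1}"
      "(J (u\<^sup>2), J (u * (u - \<sigma>))) = (J (v\<^sup>2), J (v * (v - \<sigma>)))"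
    \<comment> \<open>The first coordinate alone determines the parameter, since both parameters are
      positive.\<close>
    have "u\<^sup>2 = v\<^sup>2"
      by (rule inj_onD[OF inj_on_J]) (use uv \<sigma> in \<open>auto simp: power_le_one\<close>)
    with uv \<sigma> show "u = v" by simp
  qed
  show "(\<lambda>u. (J (u\<^sup>2), J (u * (u - \<sigma>)))) ` {\<sigma>..1} = spectral_boundary \<delta>"
  proof
    show "(\<lambda>u. (J (u\<^sup>2), J (u * (u - \<sigma>)))) ` {\<sigma>..1} \<subseteq> spectral_boundary \<delta>"
      using boundary_point[OF \<sigma>] by (auto simp: spectral_boundary_def \<sigma>_def)
    show "spectral_boundary \<delta> \<subseteq> (\<lambda>u. (J (u\<^sup>2), J (u * (u - \<sigma>)))) ` {\<sigma>..1}"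
    proof clarify
      fix a b assume "(a, b) \<in> spectral_boundary \<delta>"
      then have ab: "0 \<le> b" "b < a" "a \<le> 1/2" "Gamma_H a b = \<sigma>"
        by (auto simp: spectral_boundary_def \<sigma>_def)
      then obtain u y where u: "0 < u" "u \<le> 1" "0 \<le> y" "a = J (u\<^sup>2)" "b = J y"
        and "Gamma_H a b = (u\<^sup>2 - y) / u"
        by (auto elim: spectral_coordinates)
      with ab(4) have y: "y = u * (u - \<sigma>)"
        by (auto simp: field_simps power2_eq_square)
      \<comment> \<open>The constraint b \<ge> 0, in the form y \<ge> 0, produces the lower end of
        the parameter interval.\<close>
      with u have "\<sigma> \<le> u"
        by (simp add: zero_le_mult_iff)
      with u y show "(a, b) \<in> (\<lambda>u. (J (u\<^sup>2), J (u * (u - \<sigma>)))) ` {\<sigma>..1}"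
        by auto
    qed
  qed
qed

text \<open>The derivative log2 ((1 - t) / t) is nonnegative for 0 < t < 1/2. It blows up at 0, so
  the criterion used asks for derivatives only in the open interval and for continuity at the
  ends.\<close>

lemma H2_mono:
  assumes "0 \<le> x" "x \<le> y" "y \<le> 1/2"
  shows "H2 x \<le> H2 y"
proof (rule DERIV_nonneg_imp_increasing_open[OF assms(2)])
  fix t assume "x < t" "t < y"
  with assms have t: "0 < t" "t < 1 - t" by auto
  have "((\<lambda>t. - (t * ln t) - (1 - t) * ln (1 - t)) has_real_derivative ln (1 - t) - ln t) (at t)"
    using t by (auto intro!: derivative_eq_intros)
  then have "((\<lambda>t. (- (t * ln t) - (1 - t) * ln (1 - t)) / ln 2) has_real_derivative
      (ln (1 - t) - ln t) / ln 2) (at t)"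
    by (rule DERIV_cdivide)
  then have "(H2 has_real_derivative (ln (1 - t) - ln t) / ln 2) (at t)"
    by (simp add: H2_def[abs_def] log_def diff_divide_distrib)
  moreover have "0 \<le> (ln (1 - t) - ln t) / ln 2"
    using t by simp
  ultimately show "\<exists>D. (H2 has_real_derivative D) (at t) \<and> 0 \<le> D" by blast
next
  show "continuous_on {x..y} H2"
    by (rule continuous_on_subset[OF continuous_on_H2]) (use assms in auto)
qed

lemma R_MQC_le_kappa_H:
  assumes "0 < \<delta>" "\<delta> < 1/2"
  shows "R_MQC \<delta> \<le> kappa_H \<delta>"
  unfolding kappa_H_def
proof (rule cInf_greatest[OF kappa_H_set_nonempty])
  define \<sigma> where "\<sigma> = 1 - 2 * \<delta>"
  have \<sigma>: "0 < \<sigma>" using assms by (simp add: \<sigma>_def)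
  fix r assume "r \<in> {H2 a - H2 b |a b.
     0 \<le> b \<and> b < a \<and> a \<le> 1/2 \<and> Gamma_H a b > 1 - 2 * \<delta>}"
  then obtain a b where r: "r = H2 a - H2 b"
    and ab: "0 \<le> b" "b < a" "a \<le> 1/2" "\<sigma> < Gamma_H a b"
    by (auto simp: \<sigma>_def)
  obtain u y where u: "0 < u" "u \<le> 1" "0 \<le> y" "a = J (u\<^sup>2)" "b = J y"
    and "Gamma_H a b = (u\<^sup>2 - y) / u"
    using spectral_coordinates[OF ab(1-3)] by metis
  with ab(4) have "\<sigma> * u < u\<^sup>2 - y"
    using u(1) by (simp add: pos_less_divide_eq)
  then have y: "y < u * (u - \<sigma>)"
    by (simp add: power2_eq_square algebra_simps)
  \<comment> \<open>As y \<ge> 0, a competitor above the level \<sigma> has its \<open>u\<close> in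
    the range of the minimum, so the boundary point with the same \<open>a\<close> exists and can be
    compared with it.\<close>
  with u have "0 < u * (u - \<sigma>)" by linarith
  with u have us: "\<sigma> \<le> u"
    by (simp add: zero_less_mult_iff)
  have "R_MQC \<delta> \<le> g (u\<^sup>2) - g (u * (u - \<sigma>))"
    using R_MQC_attained[OF assms] us u by (auto simp: \<sigma>_def)
  moreover have "H2 b \<le> g (u * (u - \<sigma>))"
    unfolding g_def u(5) using y u us \<sigma> boundary_coordinate_bounds[of \<sigma> u]
    by (intro H2_mono J_nonneg J_le J_le_half) auto
  ultimately show "R_MQC \<delta> \<le> r"
    by (simp add: r u(4) g_def)
qed (use assms in simp)

text \<open>The strict inequality in \<open>kappa_H\<close> excludes the boundary point itself, so
  its value is reached as a limit of admissible values.\<close>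

lemma kappa_H_le_boundary:
  assumes "0 < \<delta>" "\<delta> < 1/2" "u \<in> {1 - 2 * \<delta>..1}"
  shows "kappa_H \<delta> \<le> g (u\<^sup>2) - g (u * (u - (1 - 2 * \<delta>)))"
proof -
  define \<sigma> where "\<sigma> = 1 - 2 * \<delta>"
  \<comment> \<open>Level and parameter move together towards 1. Raising the level with
    \<open>u\<close> fixed would violate \<open>s t \<le> u\<close> at once when u = \<sigma>; here
    the gap \<open>v t - s t\<close> equals (1 - t)(u - \<sigma>) and stays nonnegative.\<close>
  define v where "v t = u + t * (1 - u)" for t
  define s where "s t = \<sigma> + t * (1 - \<sigma>)" for t
  define F where "F t = g ((v t)\<^sup>2) - g (v t * (v t - s t))" for t
  have \<sigma>: "0 < \<sigma>" "\<sigma> < 1" "\<sigma> \<le> u" "u \<le> 1"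
    using assms by (auto simp: \<sigma>_def)
  have bds: "0 < s t" "s t \<le> v t" "v t \<le> 1" if "t \<in> {0..1}" for t
  proof -
    have "0 \<le> t * (1 - \<sigma>)" "t * (1 - u) \<le> 1 - u" "0 \<le> (1 - t) * (u - \<sigma>)"
      using that \<sigma> by (auto intro: mult_left_le_one_le)
    then show "0 < s t" "s t \<le> v t" "v t \<le> 1"
      using \<sigma> by (auto simp: s_def v_def algebra_simps)
  qed
  have contv: "continuous_on {0..1} v" and conts: "continuous_on {0..1} s"
    by (auto simp: v_def[abs_def] s_def[abs_def] intro!: continuous_intros)
  have "(v t)\<^sup>2 \<in> {0..1}" "v t * (v t - s t) \<in> {0..1}" if "t \<in> {0..1}" for t
    using boundary_coordinate_bounds[of "s t" "v t"] bds[OF that] by auto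
  then have "continuous_on {0..1} F"
    unfolding F_def[abs_def]
    by (intro continuous_on_diff continuous_on_compose2[OF continuous_on_g]
        continuous_on_power continuous_on_mult contv conts) auto
  then have "(F \<longlongrightarrow> F 0) (at 0 within {0..1})"
    by (auto simp: continuous_on_def)
  then have "(F \<longlongrightarrow> F 0) (at_right 0)"
    by (simp add: at_within_Icc_at_right)
  moreover have "\<forall>\<^sub>F t in at_right 0. kappa_H \<delta> \<le> F t"
  proof (rule eventually_at_rightI[of 0 1])
    fix t :: real assume "t \<in> {0<..<1}"
    \<comment> \<open>For t > 0 the level is strictly above \<sigma>, so \<open>F t\<close> belongs
      to the set whose infimum is \<open>kappa_H \<delta>\<close>.\<close>
    then have t: "t \<in> {0..1}" "\<sigma> < s t"
      using \<sigma> by (auto simp: s_def)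
    note bp = boundary_point[OF bds[OF t(1)]]
    show "kappa_H \<delta> \<le> F t"
      unfolding kappa_H_def
    proof (rule cInf_lower[OF _ kappa_H_set_bdd_below])
      show "F t \<in> {H2 a - H2 b |a b.
          0 \<le> b \<and> b < a \<and> a \<le> 1/2 \<and> Gamma_H a b > 1 - 2 * \<delta>}"
        using bp t(2) unfolding F_def g_def \<sigma>_def by fastforce
    qed
  qed simp
  \<comment> \<open>The bound passes to the limit, and \<open>F 0\<close> is the objective at
    \<open>u\<close> because \<open>v 0 = u\<close> and \<open>s 0 = \<sigma>\<close>.\<close>
  ultimately have "kappa_H \<delta> \<le> F 0"
    by (rule tendsto_lowerbound) simp
  then show ?thesis
    by (simp add: F_def v_def s_def \<sigma>_def)
qed

theorem propositionD1:
  fixes \<delta> \<sigma> :: real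
  assumes "0 < \<delta>" and "\<delta> < 1/2" and "\<sigma> = 1 - 2 * \<delta>"
  shows "kappa_H \<delta> = R_MQC \<delta> \<and>
    bij_betw (\<lambda>u. (J (u\<^sup>2), J (u * (u - \<sigma>)))) {\<sigma>..1} (spectral_boundary \<delta>) \<and>
    (\<forall>u\<in>{\<sigma>..1}.
       Gamma_H (J (u\<^sup>2)) (J (u * (u - \<sigma>))) = \<sigma> \<and>
       H2 (J (u\<^sup>2)) - H2 (J (u * (u - \<sigma>))) = g (u\<^sup>2) - g (u * (u - \<sigma>)))"
proof (intro conjI ballI)
  \<comment> \<open>The bound at every boundary point is applied at a minimiser.\<close>
  have "kappa_H \<delta> \<le> R_MQC \<delta>"
    using R_MQC_attained[OF assms(1,2)] kappa_H_le_boundary[OF assms(1,2)] by auto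
  with R_MQC_le_kappa_H[OF assms(1,2)] show "kappa_H \<delta> = R_MQC \<delta>"
    by simp
  show "bij_betw (\<lambda>u. (J (u\<^sup>2), J (u * (u - \<sigma>)))) {\<sigma>..1} (spectral_boundary \<delta>)"
    unfolding assms(3) using assms(2) by (rule bij_betw_spectral_boundary)
next
  fix u assume "u \<in> {\<sigma>..1}"
  then show "Gamma_H (J (u\<^sup>2)) (J (u * (u - \<sigma>))) = \<sigma>"
    using assms by (intro boundary_point) auto
  show "H2 (J (u\<^sup>2)) - H2 (J (u * (u - \<sigma>))) = g (u\<^sup>2) - g (u * (u - \<sigma>))"
    by (simp add: g_def)
qed

end
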